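(* Let $(e_i)_{i=1}^\infty$ be a $1$-subsymmetric normalized basis of a Banach space whose fundamental function is not submultiplicative. Then $(e_i)$ admits a continuum of subsymmetric block bases with (pairwise) non-equivalent fundamental functions.
   Context: A basic sequence is subsymmetric if it is unconditional and equivalent to each of its subsequences (equivalence of basic sequences $(x_j)$, $(y_j)$: $\sum a_jx_j$ converges if and only if $\sum a_jy_j$ converges). It is $1$-subsymmetric if it is $1$-unconditional and isometrically equivalent to each of its subsequences. A block basis with respect to $(e_i)$ is a sequence of non-zero vectors $y_n=\sum_{k=p_n+1}^{p_{n+1}}a_ke_k$ with $p_1<p_2<\cdots$ natural numbers. The fundamental function of a subsymmetric sequence $(u_i)$ is $\Phi(n)=\|\sum_{i=1}^nu_i\|$; it is submultiplicative if there exists $K>0$ such that $\Phi(nm)\le K\Phi(n)\Phi(m)$ for all $m,n\in\mathbb N$. Two fundamental functions $\Phi,\Psi$ are equivalent if there is $K>0$ with $K^{-1}\Phi(n)\le\Psi(n)\le K\Phi(n)$ for all $n\in\mathbb N$. "A continuum" means a family of cardinality $2^{\aleph_0}$. *)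

theory Defs
  imports "HOL-Analysis.Analysis" "HOL-Library.Equipollence"
begin

text \<open>
  Sequences are indexed from 0, so \<open>e 0, e 1, \<dots>\<close> are the vectors usually written
  \<open>e\<^sub>1, e\<^sub>2, \<dots>\<close>.  Scalars are real.
\<close>

definition schauder_basis :: "(nat \<Rightarrow> 'a::real_normed_vector) \<Rightarrow> bool" where
  "schauder_basis e \<longleftrightarrow> (\<forall>v. \<exists>!a. (\<lambda>i. a i *\<^sub>R e i) sums v)"

definition basic_sequence :: "(nat \<Rightarrow> 'a::real_normed_vector) \<Rightarrow> bool" where
  "basic_sequence x \<longleftrightarrow>
     (\<forall>v \<in> closure (span (range x)). \<exists>!a. (\<lambda>i. a i *\<^sub>R x i) sums v)"

definition normalized :: "(nat \<Rightarrow> 'a::real_normed_vector) \<Rightarrow> bool" where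
  "normalized x \<longleftrightarrow> (\<forall>i. norm (x i) = 1)"

text \<open>Unconditional: every convergent expansion stays convergent under all rearrangements.\<close>

definition unconditional :: "(nat \<Rightarrow> 'a::real_normed_vector) \<Rightarrow> bool" where
  "unconditional x \<longleftrightarrow> basic_sequence x \<and>
     (\<forall>a. summable (\<lambda>i. a i *\<^sub>R x i) \<longrightarrow>
        (\<forall>\<pi>. bij \<pi> \<longrightarrow> summable (\<lambda>i. a (\<pi> i) *\<^sub>R x (\<pi> i))))"

text \<open>1-unconditional: the unconditional constant, taken over changes of signs, is at most 1.\<close>

definition one_unconditional :: "(nat \<Rightarrow> 'a::real_normed_vector) \<Rightarrow> bool" where
  "one_unconditional x \<longleftrightarrow> unconditional x \<and>
     (\<forall>n (a :: nat \<Rightarrow> real) (\<epsilon> :: nat \<Rightarrow> real). (\<forall>i. \<epsilon> i \<in> {-1, 1}) \<longrightarrow>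
        norm (\<Sum>i<n. (\<epsilon> i * a i) *\<^sub>R x i) \<le> norm (\<Sum>i<n. a i *\<^sub>R x i))"

definition equivalent_seq ::
  "(nat \<Rightarrow> 'a::real_normed_vector) \<Rightarrow> (nat \<Rightarrow> 'b::real_normed_vector) \<Rightarrow> bool" where
  "equivalent_seq x y \<longleftrightarrow>
     (\<forall>a. summable (\<lambda>j. a j *\<^sub>R x j) \<longleftrightarrow> summable (\<lambda>j. a j *\<^sub>R y j))"

definition isometrically_equivalent_seq ::
  "(nat \<Rightarrow> 'a::real_normed_vector) \<Rightarrow> (nat \<Rightarrow> 'b::real_normed_vector) \<Rightarrow> bool" where
  "isometrically_equivalent_seq x y \<longleftrightarrow>
     (\<forall>n a. norm (\<Sum>j<n. a j *\<^sub>R x j) = norm (\<Sum>j<n. a j *\<^sub>R y j))"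

definition subsymmetric :: "(nat \<Rightarrow> 'a::real_normed_vector) \<Rightarrow> bool" where
  "subsymmetric x \<longleftrightarrow> unconditional x \<and>
     (\<forall>r :: nat \<Rightarrow> nat. strict_mono r \<longrightarrow> equivalent_seq x (x \<circ> r))"

definition one_subsymmetric :: "(nat \<Rightarrow> 'a::real_normed_vector) \<Rightarrow> bool" where
  "one_subsymmetric x \<longleftrightarrow> one_unconditional x \<and>
     (\<forall>r :: nat \<Rightarrow> nat. strict_mono r \<longrightarrow> isometrically_equivalent_seq x (x \<circ> r))"

text \<open>
  With 0-based indexing the block \<open>{p n..<p (Suc n)}\<close> consists of the vectors whose 1-based
  indices run from \<open>p n + 1\<close> to \<open>p (Suc n)\<close>.
\<close>

definition block_basis ::
  "(nat \<Rightarrow> 'a::real_normed_vector) \<Rightarrow> (nat \<Rightarrow> 'a) \<Rightarrow> bool" where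
  "block_basis e y \<longleftrightarrow>
     (\<exists>(p :: nat \<Rightarrow> nat) (a :: nat \<Rightarrow> real). strict_mono p \<and>
        (\<forall>n. y n = (\<Sum>k\<in>{p n..<p (Suc n)}. a k *\<^sub>R e k) \<and> y n \<noteq> 0))"

definition fundamental_function :: "(nat \<Rightarrow> 'a::real_normed_vector) \<Rightarrow> nat \<Rightarrow> real" where
  "fundamental_function u n = norm (\<Sum>i<n. u i)"

definition submultiplicative :: "(nat \<Rightarrow> real) \<Rightarrow> bool" where
  "submultiplicative \<Phi> \<longleftrightarrow> (\<exists>K>0. \<forall>m n. \<Phi> (n * m) \<le> K * \<Phi> n * \<Phi> m)"

definition equivalent_fun :: "(nat \<Rightarrow> real) \<Rightarrow> (nat \<Rightarrow> real) \<Rightarrow> bool" where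
  "equivalent_fun \<Phi> \<Psi> \<longleftrightarrow>
     (\<exists>K>0. \<forall>n. inverse K * \<Phi> n \<le> \<Psi> n \<and> \<Psi> n \<le> K * \<Phi> n)"

end

theory Submission
  imports Defs
begin

text \<open>
  Write \<open>\<Phi>\<close> for the fundamental function of \<open>e\<close>.  The block bases consist of successive copies of one
  infinite vector, each copy truncated to make it finite.  For a set \<open>A\<close> of indices the vector is a
  leading basis vector followed by flat pieces: for each \<open>j \<in> A\<close>, a normalized sum of \<open>N\<^sub>j\<close> basis
  vectors, multiplied by a weight \<open>c\<^sub>j\<close>.

  Such copies are always a subsymmetric block basis, by \<open>truncated_copies_subsymmetric\<close>: spreading
  copies apart is an isometry, and the truncations are a summable perturbation.

  Let \<open>\<Psi>\<^sub>A(n)\<close> be the norm of the sum of the first \<open>n\<close> copies.  It is, up to the truncation, at least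
  \<open>c\<^sub>j \<Phi>(n N\<^sub>j) / \<Phi>(N\<^sub>j)\<close> for every \<open>j \<in> A\<close> (\<open>fundamental_function_copies_ge\<close>), and at most \<open>\<Phi>(n)\<close> plus
  the sum of these numbers over \<open>A\<close> (\<open>fundamental_function_copies_le\<close>).  Because \<open>\<Phi>\<close> is not
  submultiplicative, pairs \<open>(n\<^sub>j, N\<^sub>j)\<close> can be chosen recursively with \<open>\<Phi>(n\<^sub>j N\<^sub>j)\<close> as large as desired
  compared with \<open>\<Phi>(n\<^sub>j) \<Phi>(N\<^sub>j)\<close> (\<open>not_submultiplicative_choice\<close>).  At \<open>n = n\<^sub>j\<close>, then, piece \<open>j\<close> alone
  forces \<open>\<Psi>\<^sub>A\<close> to be huge.  The other pieces contribute little: \<open>\<Phi>(n\<^sub>j N\<^sub>i) \<le> N\<^sub>i \<Phi>(n\<^sub>j)\<close> for \<open>i < j\<close>, where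
  \<open>N\<^sub>i\<close> was known when the pair for \<open>j\<close> was chosen, and \<open>\<Phi>(n\<^sub>j N\<^sub>i) \<le> n\<^sub>j \<Phi>(N\<^sub>i)\<close> for \<open>i > j\<close>, where \<open>c\<^sub>i\<close> is
  tiny compared with \<open>1 / n\<^sub>j\<close>.  So the value at \<open>n\<^sub>j\<close> detects whether \<open>j \<in> A\<close>, with a factor that tends
  to infinity, and \<open>\<Psi>\<^sub>A\<close>, \<open>\<Psi>\<^sub>B\<close> are not equivalent as soon as \<open>B - A\<close> is infinite.  There is a continuum
  of sets of which any two have infinite differences (\<open>mutually_infinite_set_diff_infinite\<close>).
\<close>

section \<open>Monotonicity and spreading of finite sums\<close>

text \<open>
  Multiplying a single coefficient by \<open>t \<in> [-1, 1]\<close> replaces the sum by a convex combination of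
  itself and of the sum with that one sign flipped, neither of which is longer than the
  original.  The coefficients are shrunk one after another.
\<close>
lemma one_unconditional_shrink:
  fixes e :: "nat \<Rightarrow> 'a::real_normed_vector"
  assumes e: "one_unconditional e" and le: "\<And>k. k < n \<Longrightarrow> \<bar>f k\<bar> \<le> \<bar>g k\<bar>"
  shows "norm (\<Sum>k<n. f k *\<^sub>R e k) \<le> norm (\<Sum>k<n. g k *\<^sub>R e k)"
proof -
  have single: "norm (\<Sum>k<n. (a(j := t * a j)) k *\<^sub>R e k) \<le> norm (\<Sum>k<n. a k *\<^sub>R e k)"
    if t: "\<bar>t\<bar> \<le> 1" for a :: "nat \<Rightarrow> real" and j t
  proof -
    let ?s = "\<Sum>k<n. a k *\<^sub>R e k"
    let ?\<epsilon> = "(\<lambda>_. 1)(j := - 1) :: nat \<Rightarrow> real"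
    let ?s' = "\<Sum>k<n. (?\<epsilon> k * a k) *\<^sub>R e k"
    have flip: "norm ?s' \<le> norm ?s"
      using e unfolding one_unconditional_def by simp
    have coef: "(a(j := t * a j)) k = (1 + t) / 2 * a k + (1 - t) / 2 * (?\<epsilon> k * a k)" for k
      by (simp add: field_simps)
    have "(\<Sum>k<n. (a(j := t * a j)) k *\<^sub>R e k) = ((1 + t) / 2) *\<^sub>R ?s + ((1 - t) / 2) *\<^sub>R ?s'"
      by (simp only: coef scaleR_sum_right scaleR_scaleR scaleR_left_distrib sum.distrib)
    also have "norm \<dots> \<le> \<bar>(1 + t) / 2\<bar> * norm ?s + \<bar>(1 - t) / 2\<bar> * norm ?s'"
      by (rule norm_triangle_le) simp
    also have "\<dots> \<le> (1 + t) / 2 * norm ?s + (1 - t) / 2 * norm ?s"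
      using t flip by (intro add_mono mult_mono) auto
    also have "\<dots> = norm ?s"
      by (simp add: field_simps)
    finally show ?thesis .
  qed
  have "norm (\<Sum>k<n. (if k < m then f k else g k) *\<^sub>R e k) \<le> norm (\<Sum>k<n. g k *\<^sub>R e k)"
    if "m \<le> n" for m
    using that
  proof (induction m)
    case (Suc m)
    let ?h = "\<lambda>k. if k < m then f k else g k"
    have fm: "\<bar>f m\<bar> \<le> \<bar>g m\<bar>"
      using le Suc.prems by simp
    then have t: "\<bar>f m / g m\<bar> \<le> 1" and fg: "f m = f m / g m * g m"
      by (auto simp: divide_simps)
    have eq: "?h(m := f m / g m * ?h m) = (\<lambda>k. if k < Suc m then f k else g k)"
      using fg by (auto simp: less_Suc_eq)
    have "norm (\<Sum>k<n. (if k < Suc m then f k else g k) *\<^sub>R e k) \<le> norm (\<Sum>k<n. ?h k *\<^sub>R e k)"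
      using single[OF t, of ?h m] unfolding eq .
    with Suc show ?case
      by simp
  qed simp
  from this[of n] show ?thesis
    by simp
qed

text \<open>
  The basis vectors are indexed through an injection \<open>g\<close> so that sums over pairs (number of a copy,
  offset inside the copy) can be compared without renumbering.
\<close>
lemma one_unconditional_mono:
  fixes e :: "nat \<Rightarrow> 'a::real_normed_vector"
  assumes e: "one_unconditional e" and J: "finite J" "inj_on g J" and IJ: "I \<subseteq> J"
    and le: "\<And>x. x \<in> I \<Longrightarrow> \<bar>f x\<bar> \<le> \<bar>h x\<bar>"
  shows "norm (\<Sum>x\<in>I. f x *\<^sub>R e (g x)) \<le> norm (\<Sum>x\<in>J. h x *\<^sub>R e (g x))"
proof -
  obtain n where n: "g ` J \<subseteq> {..<n}"
    using J(1) finite_nat_iff_bounded by blast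
  have transport: "(\<Sum>x\<in>L. u x *\<^sub>R e (g x))
      = (\<Sum>k<n. (if k \<in> g ` L then u (inv_into J g k) else 0) *\<^sub>R e k)"
    if L: "L \<subseteq> J" for L u
  proof -
    have "(\<Sum>k<n. (if k \<in> g ` L then u (inv_into J g k) else 0) *\<^sub>R e k)
        = (\<Sum>k\<in>g ` L. u (inv_into J g k) *\<^sub>R e k)"
      using n L by (intro sum.mono_neutral_cong_right) auto
    also have "\<dots> = (\<Sum>x\<in>L. u x *\<^sub>R e (g x))"
      using L J(2) by (subst sum.reindex) (auto intro: inj_on_subset simp: subset_iff)
    finally show ?thesis ..
  qed
  show ?thesis
    unfolding transport[OF IJ] transport[OF order_refl]
  proof (rule one_unconditional_shrink[OF e])
    fix k
    show "\<bar>if k \<in> g ` I then f (inv_into J g k) else 0\<bar>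
        \<le> \<bar>if k \<in> g ` J then h (inv_into J g k) else 0\<bar>"
    proof (cases "k \<in> g ` I")
      case True
      then obtain x where x: "x \<in> I" "k = g x" by blast
      with IJ J(2) have "inv_into J g k = x" by auto
      with x IJ le show ?thesis by auto
    qed simp
  qed
qed

text \<open>
  Both sums equal the one over an initial segment of the basis: listing \<open>I\<close> in the common order of
  \<open>g\<close> and \<open>h\<close> turns either map into a strictly increasing finite sequence, which extends to a
  subsequence of the basis.
\<close>
lemma one_subsymmetric_spread:
  fixes e :: "nat \<Rightarrow> 'a::real_normed_vector" and g h :: "'i \<Rightarrow> nat"
  assumes e: "one_subsymmetric e" and I: "finite I" and inj: "inj_on g I"
    and order: "\<And>x y. x \<in> I \<Longrightarrow> y \<in> I \<Longrightarrow> g x < g y \<longleftrightarrow> h x < h y"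
  shows "norm (\<Sum>x\<in>I. f x *\<^sub>R e (g x)) = norm (\<Sum>x\<in>I. f x *\<^sub>R e (h x))"
proof -
  have initial: "norm (\<Sum>i<n. a i *\<^sub>R e (s i)) = norm (\<Sum>i<n. a i *\<^sub>R e i)"
    if s: "strict_mono_on {..<n} s" for n s and a :: "nat \<Rightarrow> real"
  proof -
    \<comment> \<open>Beyond \<open>n\<close>, a shift by the sum of all \<open>s k\<close> clears every earlier value.\<close>
    define r where "r i = (if i < n then s i else i + (\<Sum>k<n. s k))" for i
    have "r i < r j" if "i < j" for i j
    proof -
      have "s i \<le> (\<Sum>k<n. s k)" if "i < n"
        using that by (intro member_le_sum) auto
      then show ?thesis
        using \<open>i < j\<close> strict_mono_onD[OF s, of i j] by (auto simp: r_def)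
    qed
    then have "strict_mono r"
      by (simp add: strict_mono_def)
    then have "isometrically_equivalent_seq e (e \<circ> r)"
      using e by (simp add: one_subsymmetric_def)
    then have "norm (\<Sum>i<n. a i *\<^sub>R e i) = norm (\<Sum>i<n. a i *\<^sub>R (e \<circ> r) i)"
      unfolding isometrically_equivalent_seq_def by blast
    also have "(\<Sum>i<n. a i *\<^sub>R (e \<circ> r) i) = (\<Sum>i<n. a i *\<^sub>R e (s i))"
      by (simp add: r_def)
    finally show ?thesis ..
  qed
  obtain s where s: "bij_betw s {..<card (g ` I)} (g ` I)" "strict_mono_on {..<card (g ` I)} s"
    using ex_bij_betw_strict_mono_card[of "g ` I"] I by blast
  let ?n = "card (g ` I)" and ?t = "inv_into I g \<circ> s"
  have t: "bij_betw ?t {..<?n} I"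
    using s(1) bij_betw_trans bij_betw_inv_into[OF inj_on_imp_bij_betw[OF inj]] by blast
  have gt: "g (?t i) = s i" if "i < ?n" for i
    using s(1) that by (auto simp: bij_betw_def intro!: f_inv_into_f)
  have g_mono: "strict_mono_on {..<?n} (g \<circ> ?t)"
    using s(2) gt by (auto simp: strict_mono_on_def)
  have h_mono: "strict_mono_on {..<?n} (h \<circ> ?t)"
  proof (rule strict_mono_onI)
    fix i j assume "i \<in> {..<?n}" "j \<in> {..<?n}" "i < j"
    then show "(h \<circ> ?t) i < (h \<circ> ?t) j"
      using order[of "?t i" "?t j"] t strict_mono_onD[OF g_mono, of i j]
      by (metis bij_betwE comp_apply)
  qed
  have enum: "(\<Sum>x\<in>I. f x *\<^sub>R e (u x)) = (\<Sum>i<?n. (f \<circ> ?t) i *\<^sub>R e ((u \<circ> ?t) i))" for u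
    using sum.reindex_bij_betw[OF t, of "\<lambda>x. f x *\<^sub>R e (u x)"] by simp
  show ?thesis
    unfolding enum using initial[OF g_mono] initial[OF h_mono] by metis
qed

lemma norm_sum_basis_eq_fundamental_function:
  fixes e :: "nat \<Rightarrow> 'a::real_normed_vector"
  assumes e: "one_subsymmetric e" and I: "finite I" "inj_on g I"
  shows "norm (\<Sum>x\<in>I. e (g x)) = fundamental_function e (card I)"
proof -
  obtain s where s: "bij_betw s {..<card (g ` I)} (g ` I)" "strict_mono_on {..<card (g ` I)} s"
    using ex_bij_betw_strict_mono_card[of "g ` I"] I by blast
  have "(\<Sum>x\<in>I. e (g x)) = (\<Sum>k\<in>g ` I. e k)"
    using I by (simp add: sum.reindex)
  also have "\<dots> = (\<Sum>i<card I. 1 *\<^sub>R e (s i))"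
    using sum.reindex_bij_betw[OF s(1), of e] I by (simp add: card_image)
  also have "norm \<dots> = norm (\<Sum>i<card I. 1 *\<^sub>R e (id i))"
    using s(2) I
    by (intro one_subsymmetric_spread[OF e])
       (auto simp: card_image strict_mono_on_less strict_mono_on_imp_inj_on)
  finally show ?thesis
    by (simp add: fundamental_function_def)
qed

text \<open>
  A finite set of late indices is mapped by the injection \<open>\<pi>\<close> into a late interval, and
  suppressing terms of the sum over that interval only decreases its norm.  So the
  rearranged series is Cauchy.
\<close>
lemma summable_reindex_of_suppression:
  fixes z :: "nat \<Rightarrow> 'a::banach"
  assumes z: "summable z"
    and suppress: "\<And>F G. finite G \<Longrightarrow> F \<subseteq> G \<Longrightarrow> norm (sum z F) \<le> norm (sum z G)"
    and \<pi>: "inj \<pi>"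
  shows "summable (\<lambda>i. z (\<pi> i))"
  unfolding summable_Cauchy
proof (intro allI impI)
  fix \<epsilon> :: real assume "\<epsilon> > 0"
  then obtain N where N: "\<And>m n. m \<ge> N \<Longrightarrow> norm (sum z {m..<n}) < \<epsilon>"
    using z unfolding summable_Cauchy by blast
  have "finite (\<pi> -` {..<N})"
    using \<pi> by (simp add: finite_vimageI)
  then obtain N' where N': "\<pi> -` {..<N} \<subseteq> {..<N'}"
    using finite_nat_iff_bounded by blast
  have "norm (\<Sum>i=m..<n. z (\<pi> i)) < \<epsilon>" if "m \<ge> N'" for m n
  proof -
    obtain M where M: "\<pi> ` {m..<n} \<subseteq> {..<M}"
      using finite_nat_iff_bounded by blast
    have sub: "\<pi> ` {m..<n} \<subseteq> {N..<M}"
    proof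
      fix k assume k: "k \<in> \<pi> ` {m..<n}"
      then obtain i where i: "k = \<pi> i" "m \<le> i" by auto
      have "\<not> \<pi> i < N"
        using N' i \<open>m \<ge> N'\<close> by force
      with i k M show "k \<in> {N..<M}" by auto
    qed
    have "(\<Sum>i=m..<n. z (\<pi> i)) = sum z (\<pi> ` {m..<n})"
      using \<pi> by (simp add: sum.reindex inj_on_subset)
    also have "norm \<dots> \<le> norm (sum z {N..<M})"
      using sub by (intro suppress) auto
    also have "\<dots> < \<epsilon>"
      by (rule N) simp
    finally show ?thesis .
  qed
  then show "\<exists>N. \<forall>m\<ge>N. \<forall>n. norm (\<Sum>i=m..<n. z (\<pi> i)) < \<epsilon>"
    by blast
qed

section \<open>Block bases of a 1-unconditional basis are unconditional\<close>

text \<open>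
  Otherwise \<open>0\<close> would have two expansions.
\<close>
lemma schauder_basis_nonzero:
  assumes "schauder_basis e"
  shows "e k \<noteq> 0"
proof
  assume ek: "e k = 0"
  have unique: "a = b" if "(\<lambda>i. a i *\<^sub>R e i) sums 0" "(\<lambda>i. b i *\<^sub>R e i) sums 0" for a b
    using assms that unfolding schauder_basis_def by blast
  have "(\<lambda>i. (if i = k then 1 else 0) *\<^sub>R e i) = (\<lambda>_. 0)"
    using ek by auto
  then have "(\<lambda>i. if i = k then 1 else 0 :: real) = (\<lambda>_. 0)"
    by (intro unique) simp_all
  then show False
    by (metis zero_neq_one)
qed

lemma one_unconditional_coordinate_le:
  fixes e :: "nat \<Rightarrow> 'a::real_normed_vector"
  assumes e: "one_unconditional e" and a: "(\<lambda>i. a i *\<^sub>R e i) sums v"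
  shows "\<bar>a k\<bar> * norm (e k) \<le> norm v"
proof (rule LIMSEQ_le_const)
  show "(\<lambda>n. norm (\<Sum>i<n. a i *\<^sub>R e i)) \<longlonglongrightarrow> norm v"
    using a unfolding sums_def by (rule tendsto_norm)
  have "\<bar>a k\<bar> * norm (e k) \<le> norm (\<Sum>i<n. a i *\<^sub>R e i)" if "n \<ge> Suc k" for n
    using one_unconditional_mono[OF e, of "{..<n}" "\<lambda>x. x" "{k}" a a] that by auto
  then show "\<exists>N. \<forall>n\<ge>N. \<bar>a k\<bar> * norm (e k) \<le> norm (\<Sum>i<n. a i *\<^sub>R e i)"
    by blast
qed

lemma block_index_unique:
  fixes p :: "nat \<Rightarrow> nat"
  assumes "strict_mono p" "k \<in> {p i..<p (Suc i)}" "k \<in> {p j..<p (Suc j)}"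
  shows "i = j"
proof -
  have "p (Suc i) \<le> p j" if "i < j" for i j
    using that assms(1) by (simp add: strict_mono_less_eq)
  with assms(2,3) show ?thesis
    by (metis atLeastLessThan_iff linorder_neqE_nat not_le order_le_less_trans)
qed

lemma block_basis_suppression:
  fixes e :: "nat \<Rightarrow> 'a::real_normed_vector"
  assumes e: "one_unconditional e" and y: "block_basis e y" and G: "finite G" "F \<subseteq> G"
  shows "norm (\<Sum>i\<in>F. b i *\<^sub>R y i) \<le> norm (\<Sum>i\<in>G. b i *\<^sub>R y i)"
proof -
  obtain p \<alpha> where p: "strict_mono p"
    and y: "\<And>n. y n = (\<Sum>k\<in>{p n..<p (Suc n)}. \<alpha> k *\<^sub>R e k)"
    using y unfolding block_basis_def by blast
  let ?B = "\<lambda>i. {p i..<p (Suc i)}"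
  have eq: "(\<Sum>i\<in>H. b i *\<^sub>R y i) = (\<Sum>x\<in>Sigma H ?B. (b (fst x) * \<alpha> (snd x)) *\<^sub>R e (snd x))"
    if "finite H" for H
    using that by (simp add: y scaleR_sum_right sum.Sigma case_prod_unfold)
  have "inj_on snd (Sigma G ?B)"
    using block_index_unique[OF p] by (auto simp: inj_on_def simp del: atLeastLessThan_iff)
  then show ?thesis
    unfolding eq[OF G(1)] eq[OF finite_subset[OF G(2,1)]]
    using G by (intro one_unconditional_mono[OF e]) auto
qed

lemma sum_blocks:
  fixes f :: "nat \<Rightarrow> 'a::comm_monoid_add"
  assumes "strict_mono p"
  shows "(\<Sum>i<n. \<Sum>k\<in>{p i..<p (Suc i)}. f k) = (\<Sum>k\<in>{p 0..<p n}. f k)"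
proof (induction n)
  case (Suc n)
  then show ?case
    using assms by (simp add: sum.atLeastLessThan_concat strict_mono_less_eq)
qed simp

text \<open>
  An expansion \<open>\<Sum> a\<^sub>k e\<^sub>k\<close> can be regrouped along the blocks exactly if \<open>a\<close> vanishes before the first
  block and is proportional, on every block, to the coefficients \<open>\<alpha>\<close> of the block vector.  These
  are equations between finitely many coordinates at a time; they hold on the span of the blocks,
  and since coordinates depend continuously on the vector they persist on its closure.
  Proportionality is cross-multiplied because single coefficients of \<open>\<alpha>\<close> may vanish.
\<close>
lemma block_basis_basic_sequence:
  fixes e :: "nat \<Rightarrow> 'a::banach"
  assumes basis: "schauder_basis e" and e: "one_unconditional e" and block: "block_basis e y"
  shows "basic_sequence y"
proof -
  obtain p \<alpha> where p: "strict_mono p"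
    and y: "\<And>n. y n = (\<Sum>k\<in>{p n..<p (Suc n)}. \<alpha> k *\<^sub>R e k)" and y0: "\<And>n. y n \<noteq> 0"
    using block unfolding block_basis_def by blast
  let ?B = "\<lambda>i. {p i..<p (Suc i)}"
  define good where "good a \<longleftrightarrow> (\<forall>k<p 0. a k = 0) \<and>
    (\<forall>i. \<forall>k\<in>?B i. \<forall>l\<in>?B i. a k * \<alpha> l = a l * \<alpha> k)" for a :: "nat \<Rightarrow> real"
  have good_combine: "good (\<lambda>k. c * a k + b k)" if a: "good a" and b: "good b" for a b c
  proof -
    have "(c * a k + b k) * \<alpha> l = (c * a l + b l) * \<alpha> k" if "k \<in> ?B i" "l \<in> ?B i" for i k l
    proof -
      have "(c * a k + b k) * \<alpha> l = c * (a k * \<alpha> l) + b k * \<alpha> l"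
        by (simp add: distrib_right)
      also have "a k * \<alpha> l = a l * \<alpha> k"
        using a that unfolding good_def by blast
      also have "b k * \<alpha> l = b l * \<alpha> k"
        using b that unfolding good_def by blast
      finally show ?thesis
        by (simp add: distrib_right)
    qed
    moreover have "c * a k + b k = 0" if "k < p 0" for k
    proof -
      have "a k = 0" "b k = 0"
        using a b that unfolding good_def by blast+
      then show ?thesis by simp
    qed
    ultimately show ?thesis
      unfolding good_def by blast
  qed
  have span: "\<exists>a. good a \<and> (\<lambda>k. a k *\<^sub>R e k) sums w" if "w \<in> span (range y)" for w
    using that
  proof (induction rule: span_induct_alt)
    case base
    show ?case
      by (rule exI[of _ "\<lambda>_. 0"]) (simp add: good_def)
  next
    case (step c x w)
    then obtain i a where x: "x = y i" and a: "good a" "(\<lambda>k. a k *\<^sub>R e k) sums w"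
      by blast
    let ?a' = "\<lambda>k. if k \<in> ?B i then \<alpha> k else 0"
    have good': "good ?a'"
    proof -
      have "?a' k * \<alpha> l = ?a' l * \<alpha> k" if "k \<in> ?B j" "l \<in> ?B j" for j k l
      proof (cases "i = j")
        case False
        then have "k \<notin> ?B i" "l \<notin> ?B i"
          using that block_index_unique[OF p] by blast+
        then show ?thesis by (simp only: if_False mult_zero_left)
      qed (use that in simp)
      moreover have "?a' k = 0" if "k < p 0" for k
        using that strict_mono_less_eq[OF p, of 0 i] by auto
      ultimately show ?thesis
        unfolding good_def by blast
    qed
    have "(\<lambda>k. ?a' k *\<^sub>R e k) sums (\<Sum>k\<in>?B i. ?a' k *\<^sub>R e k)"
      by (rule sums_finite) auto
    then have x': "(\<lambda>k. ?a' k *\<^sub>R e k) sums x"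
      by (simp add: x y)
    have "good (\<lambda>k. c * ?a' k + a k)"
      by (rule good_combine[OF good' a(1)])
    moreover have "(\<lambda>k. (c * ?a' k + a k) *\<^sub>R e k) sums (c *\<^sub>R x + w)"
      using sums_add[OF sums_scaleR_right[OF x', of c] a(2)]
      by (simp only: scaleR_add_left scaleR_scaleR)
    ultimately show ?case
      by blast
  qed
  have closed: "good a" if v: "v \<in> closure (span (range y))" and a: "(\<lambda>k. a k *\<^sub>R e k) sums v" for v a
  proof -
    have approx: "\<exists>c. good c \<and> \<bar>a k - c k\<bar> \<le> \<epsilon> \<and> \<bar>a l - c l\<bar> \<le> \<epsilon>" if \<epsilon>: "\<epsilon> > 0" for k l \<epsilon>
    proof -
      define \<delta> where "\<delta> = \<epsilon> * min (norm (e k)) (norm (e l))"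
      have "\<delta> > 0"
        using \<epsilon> schauder_basis_nonzero[OF basis] by (simp add: \<delta>_def)
      then obtain w where w: "w \<in> span (range y)" "dist w v < \<delta>"
        using v unfolding closure_approachable by blast
      then obtain c where c: "good c" "(\<lambda>k. c k *\<^sub>R e k) sums w"
        using span by blast
      have diff: "(\<lambda>k. (a k - c k) *\<^sub>R e k) sums (v - w)"
        using sums_diff[OF a c(2)] by (simp add: scaleR_diff_left)
      have "\<bar>a m - c m\<bar> \<le> \<epsilon>" if "m \<in> {k, l}" for m
      proof -
        have "\<bar>a m - c m\<bar> * norm (e m) \<le> norm (v - w)"
          by (rule one_unconditional_coordinate_le[OF e diff])
        also have "\<dots> \<le> \<delta>"
          using w(2) by (simp add: dist_norm norm_minus_commute)
        also have "\<dots> \<le> \<epsilon> * norm (e m)"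
          using \<epsilon> that by (auto simp: \<delta>_def)
        finally show ?thesis
          using schauder_basis_nonzero[OF basis, of m] by simp
      qed
      with c(1) show ?thesis by blast
    qed
    have zero: "a k = 0" if "k < p 0" for k
    proof -
      have "\<bar>a k\<bar> \<le> 0 + \<epsilon>" if \<epsilon>: "\<epsilon> > 0" for \<epsilon>
      proof -
        obtain c where c: "good c" "\<bar>a k - c k\<bar> \<le> \<epsilon>"
          using approx[OF \<epsilon>, of k k] by blast
        have "c k = 0"
          using c(1) \<open>k < p 0\<close> unfolding good_def by blast
        with c(2) show ?thesis by simp
      qed
      then have "\<bar>a k\<bar> \<le> 0"
        by (rule field_le_epsilon)
      then show ?thesis by simp
    qed
    have "a k * \<alpha> l = a l * \<alpha> k" if "k \<in> ?B i" "l \<in> ?B i" for i k l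
    proof -
      have "\<bar>a k * \<alpha> l - a l * \<alpha> k\<bar> \<le> 0 + \<epsilon>" if \<epsilon>: "\<epsilon> > 0" for \<epsilon>
      proof -
        \<comment> \<open>The summand 1 only keeps the divisor positive when both coefficients vanish.\<close>
        let ?M = "\<bar>\<alpha> l\<bar> + \<bar>\<alpha> k\<bar> + 1"
        have M: "?M > 0" by (simp add: add_nonneg_pos)
        then obtain c where c: "good c" "\<bar>a k - c k\<bar> \<le> \<epsilon> / ?M" "\<bar>a l - c l\<bar> \<le> \<epsilon> / ?M"
          using approx[of "\<epsilon> / ?M" k l] \<epsilon> by auto
        have "c k * \<alpha> l = c l * \<alpha> k"
          using c(1) \<open>k \<in> ?B i\<close> \<open>l \<in> ?B i\<close> unfolding good_def by blast
        moreover have "(a k - c k) * \<alpha> l - (a l - c l) * \<alpha> k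
            = (a k * \<alpha> l - a l * \<alpha> k) - (c k * \<alpha> l - c l * \<alpha> k)"
          by (simp add: algebra_simps)
        ultimately have "\<bar>a k * \<alpha> l - a l * \<alpha> k\<bar> = \<bar>(a k - c k) * \<alpha> l - (a l - c l) * \<alpha> k\<bar>"
          by simp
        also have "\<dots> \<le> \<bar>a k - c k\<bar> * \<bar>\<alpha> l\<bar> + \<bar>a l - c l\<bar> * \<bar>\<alpha> k\<bar>"
          using abs_triangle_ineq4[of "(a k - c k) * \<alpha> l" "(a l - c l) * \<alpha> k"]
          by (simp add: abs_mult)
        also have "\<dots> \<le> \<epsilon> / ?M * \<bar>\<alpha> l\<bar> + \<epsilon> / ?M * \<bar>\<alpha> k\<bar>"
          using c by (intro add_mono mult_right_mono) auto
        also have "\<dots> = \<epsilon> / ?M * (\<bar>\<alpha> l\<bar> + \<bar>\<alpha> k\<bar>)"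
          by (simp add: distrib_left)
        also have "\<dots> \<le> \<epsilon> / ?M * ?M"
          using M \<epsilon> by (intro mult_left_mono) auto
        also have "\<dots> = 0 + \<epsilon>"
          using M by simp
        finally show ?thesis .
      qed
      then have "\<bar>a k * \<alpha> l - a l * \<alpha> k\<bar> \<le> 0"
        by (rule field_le_epsilon)
      then show ?thesis by simp
    qed
    with zero show ?thesis
      unfolding good_def by blast
  qed
  show ?thesis
    unfolding basic_sequence_def
  proof (intro ballI ex_ex1I)
    fix v assume v: "v \<in> closure (span (range y))"
    obtain a where a: "(\<lambda>k. a k *\<^sub>R e k) sums v"
      using basis unfolding schauder_basis_def by blast
    have good: "good a"
      by (rule closed[OF v a])
    have "\<exists>b. \<forall>k\<in>?B i. a k = b * \<alpha> k" for i
    proof -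
      have "\<exists>l\<in>?B i. \<alpha> l \<noteq> 0"
      proof (rule ccontr)
        assume none: "\<not> (\<exists>l\<in>?B i. \<alpha> l \<noteq> 0)"
        have "y i = 0"
          unfolding y by (rule sum.neutral) (use none in auto)
        with y0 show False by blast
      qed
      then obtain l where l: "l \<in> ?B i" "\<alpha> l \<noteq> 0"
        by blast
      have "a k = (a l / \<alpha> l) * \<alpha> k" if "k \<in> ?B i" for k
      proof -
        have "a k * \<alpha> l = a l * \<alpha> k"
          using good l(1) that unfolding good_def by blast
        with l(2) show ?thesis
          by (simp add: eq_divide_eq)
      qed
      then show ?thesis by blast
    qed
    then obtain b where b: "\<And>i k. k \<in> ?B i \<Longrightarrow> a k = b i * \<alpha> k"
      by metis
    have before: "a k = 0" if "k < p 0" for k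
      using good that unfolding good_def by blast
    have partial: "(\<Sum>i<n. b i *\<^sub>R y i) = (\<Sum>k<p n. a k *\<^sub>R e k)" for n
    proof -
      have "(\<Sum>i<n. b i *\<^sub>R y i) = (\<Sum>i<n. \<Sum>k\<in>?B i. a k *\<^sub>R e k)"
        using b by (simp add: y scaleR_sum_right)
      also have "\<dots> = (\<Sum>k\<in>{p 0..<p n}. a k *\<^sub>R e k)"
        by (rule sum_blocks[OF p])
      also have "\<dots> = (\<Sum>k<p n. a k *\<^sub>R e k)"
        using before by (intro sum.mono_neutral_left) auto
      finally show ?thesis .
    qed
    have "(\<lambda>n. \<Sum>k<p n. a k *\<^sub>R e k) \<longlonglongrightarrow> v"
      using LIMSEQ_subseq_LIMSEQ[OF a[unfolded sums_def] p] by (simp add: o_def)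
    then show "\<exists>b. (\<lambda>i. b i *\<^sub>R y i) sums v"
      unfolding sums_def partial[symmetric] by blast
  next
    fix v b b'
    assume b: "(\<lambda>i. b i *\<^sub>R y i) sums v" and b': "(\<lambda>i. b' i *\<^sub>R y i) sums v"
    have diff: "(\<lambda>i. (b i - b' i) *\<^sub>R y i) sums 0"
      using sums_diff[OF b b'] by (simp add: scaleR_diff_left)
    have zero: "norm ((b i - b' i) *\<^sub>R y i) \<le> norm (0 :: 'a)" for i
    proof (rule LIMSEQ_le_const)
      show "(\<lambda>n. norm (\<Sum>j<n. (b j - b' j) *\<^sub>R y j)) \<longlonglongrightarrow> norm (0 :: 'a)"
        using diff unfolding sums_def by (rule tendsto_norm)
      have "norm ((b i - b' i) *\<^sub>R y i) \<le> norm (\<Sum>j<n. (b j - b' j) *\<^sub>R y j)" if "n \<ge> Suc i" for n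
        using block_basis_suppression[OF e block, of "{..<n}" "{i}" "\<lambda>j. b j - b' j"] that by simp
      then show "\<exists>N. \<forall>n\<ge>N. norm ((b i - b' i) *\<^sub>R y i) \<le> norm (\<Sum>j<n. (b j - b' j) *\<^sub>R y j)"
        by blast
    qed
    show "b = b'"
    proof
      fix i
      show "b i = b' i"
        using zero[of i] y0[of i] by (simp add: mult_le_0_iff)
    qed
  qed
qed

lemma block_basis_unconditional:
  fixes e :: "nat \<Rightarrow> 'a::banach"
  assumes "schauder_basis e" and e: "one_unconditional e" and y: "block_basis e y"
  shows "unconditional y"
  unfolding unconditional_def
proof (intro conjI allI impI)
  show "basic_sequence y"
    using assms by (rule block_basis_basic_sequence)
  fix a :: "nat \<Rightarrow> real" and \<pi> :: "nat \<Rightarrow> nat"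
  assume a: "summable (\<lambda>i. a i *\<^sub>R y i)" and \<pi>: "bij \<pi>"
  show "summable (\<lambda>i. a (\<pi> i) *\<^sub>R y (\<pi> i))"
    by (rule summable_reindex_of_suppression[OF a block_basis_suppression[OF e y] bij_is_inj[OF \<pi>]])
qed

section \<open>Truncated copies of a vector\<close>

definition copy_start :: "(nat \<Rightarrow> nat) \<Rightarrow> nat \<Rightarrow> nat" where
  "copy_start q i = (\<Sum>l<i. q l)"

text \<open>
  Copy \<open>i\<close> of the vector \<open>\<Sum> v\<^sub>d e\<^sub>d\<close> keeps only its first \<open>q i\<close> coordinates, since a block must be finite
  even when the vector is not.
\<close>
definition truncated_copies ::
  "(nat \<Rightarrow> 'a::real_vector) \<Rightarrow> (nat \<Rightarrow> real) \<Rightarrow> (nat \<Rightarrow> nat) \<Rightarrow> nat \<Rightarrow> 'a" where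
  "truncated_copies e v q i = (\<Sum>d<q i. v d *\<^sub>R e (copy_start q i + d))"

lemma copy_start_separated:
  assumes "i < j"
  shows "copy_start q i + q i \<le> copy_start q j"
proof -
  have "copy_start q i + q i = (\<Sum>l<Suc i. q l)"
    by (simp add: copy_start_def)
  also have "\<dots> \<le> copy_start q j"
    using assms unfolding copy_start_def by (intro sum_mono2) auto
  finally show ?thesis .
qed

text \<open>
  Wherever the copies begin, as long as they keep their order and do not overlap, the positions
  are ordered lexicographically.  This is why moving the copies apart does not change norms.
\<close>
lemma position_less_iff:
  fixes P q :: "nat \<Rightarrow> nat"
  assumes sep: "\<And>i j. i < j \<Longrightarrow> P i + q i \<le> P j" and "d < q i" "d' < q i'"
  shows "P i + d < P i' + d' \<longleftrightarrow> i < i' \<or> i = i' \<and> d < d'"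
  using assms(2,3) sep[of i i'] sep[of i' i] by (cases i i' rule: linorder_cases) auto

lemma position_inj_on:
  fixes P q :: "nat \<Rightarrow> nat"
  assumes sep: "\<And>i j. i < j \<Longrightarrow> P i + q i \<le> P j"
  shows "inj_on (\<lambda>(i, d). P i + d) (Sigma F (\<lambda>i. {..<q i}))"
proof -
  have "i = i' \<and> d = d'" if d: "d < q i" "d' < q i'" and eq: "P i + d = P i' + d'" for i d i' d'
  proof -
    have less: "P i + d < P i' + d' \<longleftrightarrow> i < i' \<or> i = i' \<and> d < d'"
      by (rule position_less_iff[of P q]) (use sep d in auto)
    have greater: "P i' + d' < P i + d \<longleftrightarrow> i' < i \<or> i' = i \<and> d' < d"
      by (rule position_less_iff[of P q]) (use sep d in auto)
    show ?thesis
      using less greater eq by auto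
  qed
  then show ?thesis
    by (auto simp: inj_on_def)
qed

lemma spread_copies:
  fixes e :: "nat \<Rightarrow> 'a::real_normed_vector" and P P' q :: "nat \<Rightarrow> nat"
  assumes e: "one_subsymmetric e" and F: "finite F"
    and P: "\<And>i j. i < j \<Longrightarrow> P i + q i \<le> P j" and P': "\<And>i j. i < j \<Longrightarrow> P' i + q i \<le> P' j"
  shows "norm (\<Sum>i\<in>F. \<Sum>d<q i. f i d *\<^sub>R e (P i + d)) = norm (\<Sum>i\<in>F. \<Sum>d<q i. f i d *\<^sub>R e (P' i + d))"
proof -
  let ?g = "\<lambda>P x. case x of (i, d) \<Rightarrow> P i + d"
  have "norm (\<Sum>x\<in>Sigma F (\<lambda>i. {..<q i}). f (fst x) (snd x) *\<^sub>R e (?g P x))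
      = norm (\<Sum>x\<in>Sigma F (\<lambda>i. {..<q i}). f (fst x) (snd x) *\<^sub>R e (?g P' x))"
  proof (rule one_subsymmetric_spread[OF e])
    show "inj_on (?g P) (Sigma F (\<lambda>i. {..<q i}))"
      using position_inj_on[of P q F, OF P] by simp
    fix x x' assume "x \<in> Sigma F (\<lambda>i. {..<q i})" "x' \<in> Sigma F (\<lambda>i. {..<q i})"
    then show "?g P x < ?g P x' \<longleftrightarrow> ?g P' x < ?g P' x'"
      by (auto simp: position_less_iff[of P q, OF P] position_less_iff[of P' q, OF P'])
  qed (use F in auto)
  then show ?thesis
    using F by (simp add: sum.Sigma case_prod_unfold)
qed

lemma norm_truncated_copy_ge:
  fixes e :: "nat \<Rightarrow> 'a::real_normed_vector"
  assumes "one_unconditional e" "normalized e" "q i > 0"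
  shows "\<bar>v 0\<bar> \<le> norm (truncated_copies e v q i)"
  using one_unconditional_mono[OF assms(1), of "{..<q i}" "\<lambda>d. copy_start q i + d" "{0}" v v] assms
  by (simp add: truncated_copies_def normalized_def)

text \<open>
  The coefficients do not depend on the block but only on the offset inside it; they are assembled
  into one sequence by looking up the block that contains a given position.
\<close>
lemma truncated_copies_block_basis:
  fixes e :: "nat \<Rightarrow> 'a::real_normed_vector"
  assumes e: "one_unconditional e" "normalized e" and q: "\<And>i. q i > 0" and v: "v 0 \<noteq> 0"
  shows "block_basis e (truncated_copies e v q)"
proof -
  let ?p = "copy_start q"
  have p: "strict_mono ?p"
    using q by (simp add: strict_mono_Suc_iff copy_start_def)
  have pSuc: "?p (Suc i) = ?p i + q i" for i
    by (simp add: copy_start_def)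
  define a where "a k = v (k - ?p (THE i. k \<in> {?p i..<?p (Suc i)}))" for k
  have a: "a (?p i + d) = v d" if "d < q i" for i d
  proof -
    have "(THE j. ?p i + d \<in> {?p j..<?p (Suc j)}) = i"
      using that by (intro the_equality block_index_unique[OF p]) (auto simp: pSuc)
    then show ?thesis
      by (simp add: a_def)
  qed
  have "truncated_copies e v q i = (\<Sum>k\<in>{?p i..<?p (Suc i)}. a k *\<^sub>R e k)" for i
  proof -
    have "(\<Sum>k\<in>{?p i..<?p (Suc i)}. a k *\<^sub>R e k) = (\<Sum>d<q i. a (?p i + d) *\<^sub>R e (?p i + d))"
      using sum.shift_bounds_nat_ivl[of "\<lambda>k. a k *\<^sub>R e k" 0 "?p i" "q i"]
      by (simp add: pSuc add.commute lessThan_atLeast0)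
    then show ?thesis
      by (simp add: truncated_copies_def a)
  qed
  moreover have "truncated_copies e v q i \<noteq> 0" for i
    using norm_truncated_copy_ge[OF e, of q i v] q[of i] v by auto
  ultimately show ?thesis
    using p unfolding block_basis_def by blast
qed

text \<open>
  In a subsequence, copy \<open>i\<close> becomes copy \<open>r i \<ge> i\<close>, truncated later.  Its first \<open>q i\<close> coordinates
  form a sequence that is isometric to the original one by spreading; the excess is a
  piece of the tail of \<open>v\<close>, hence has summable norms, and the coefficients of a convergent series
  are bounded because \<open>v 0 \<noteq> 0\<close> keeps the copies away from 0.  Conversely, dropping the excess
  only shrinks norms.
\<close>
lemma truncated_copies_subsymmetric:
  fixes e :: "nat \<Rightarrow> 'a::banach"
  assumes basis: "schauder_basis e" and norm: "normalized e" and e: "one_subsymmetric e"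
    and q: "strict_mono q" "q 0 > 0" and v: "v 0 \<noteq> 0"
    and tail: "\<And>i m. i \<le> m \<Longrightarrow> norm (\<Sum>d\<in>{q i..<q m}. v d *\<^sub>R e d) \<le> t i" and t: "summable t"
  shows "subsymmetric (truncated_copies e v q)"
proof -
  let ?p = "copy_start q" and ?y = "truncated_copies e v q"
  have unc: "one_unconditional e"
    using e by (simp add: one_subsymmetric_def)
  have q_pos: "q i > 0" for i
    using q strict_mono_less_eq[OF q(1), of 0 i] by simp
  have block: "block_basis e ?y"
    by (rule truncated_copies_block_basis) (use unc norm q_pos v in auto)
  have "equivalent_seq ?y (?y \<circ> r)" if r: "strict_mono r" for r :: "nat \<Rightarrow> nat"
    unfolding equivalent_seq_def
  proof (intro allI iffI)
    fix b :: "nat \<Rightarrow> real"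
    have q_le: "q i \<le> q (r i)" for i
      using strict_mono_imp_increasing[OF r, of i] q(1) by (simp add: strict_mono_less_eq)
    \<comment> \<open>\<open>y'\<close> collects the coordinates that copy \<open>i\<close> already has, \<open>z\<close> the excess of copy \<open>r i\<close>.\<close>
    define y' where "y' i = (\<Sum>d<q i. v d *\<^sub>R e (?p (r i) + d))" for i
    define z where "z i = (\<Sum>d\<in>{q i..<q (r i)}. v d *\<^sub>R e (?p (r i) + d))" for i
    have split: "?y (r i) = y' i + z i" for i
      using q_le[of i] by (simp add: truncated_copies_def y'_def z_def lessThan_atLeast0
          sum.atLeastLessThan_concat)
    have sep_r: "?p (r i) + q i \<le> ?p (r j)" if "i < j" for i j
      using copy_start_separated[of "r i" "r j" q] that r q_le[of i]
      by (simp add: strict_mono_less)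
    have sep_r': "?p (r i) + q (r i) \<le> ?p (r j)" if "i < j" for i j
      using copy_start_separated[of "r i" "r j" q] that r by (simp add: strict_mono_less)
    have iso: "norm (\<Sum>i\<in>F. b i *\<^sub>R y' i) = norm (\<Sum>i\<in>F. b i *\<^sub>R ?y i)" if "finite F" for F
      using spread_copies[OF e that, of "\<lambda>i. ?p (r i)" q ?p "\<lambda>i d. b i * v d"]
        sep_r copy_start_separated
      by (simp add: truncated_copies_def y'_def scaleR_sum_right)
    have summable_iff: "summable (\<lambda>i. b i *\<^sub>R y' i) \<longleftrightarrow> summable (\<lambda>i. b i *\<^sub>R ?y i)"
      unfolding summable_Cauchy by (simp add: iso)
    have "norm (z i) \<le> t i" for i
    proof -
      have "norm (z i) = norm (\<Sum>d\<in>{q i..<q (r i)}. v d *\<^sub>R e d)"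
        unfolding z_def by (rule one_subsymmetric_spread[OF e]) auto
      also have "\<dots> \<le> t i"
        using strict_mono_imp_increasing[OF r] by (intro tail) auto
      finally show ?thesis .
    qed
    note z = this
    show "summable (\<lambda>i. b i *\<^sub>R (?y \<circ> r) i)" if b: "summable (\<lambda>i. b i *\<^sub>R ?y i)"
    proof -
      have "Bseq (\<lambda>i. b i *\<^sub>R ?y i)"
        using summable_LIMSEQ_zero[OF b] convergentI convergent_imp_Bseq by blast
      then obtain C where C: "\<And>i. norm (b i *\<^sub>R ?y i) \<le> C"
        unfolding Bseq_def by blast
      have bound: "\<bar>b i\<bar> \<le> C / \<bar>v 0\<bar>" for i
      proof -
        have "\<bar>b i\<bar> * \<bar>v 0\<bar> \<le> \<bar>b i\<bar> * norm (?y i)"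
          using norm_truncated_copy_ge[OF unc norm, of q i v] q_pos[of i] by (intro mult_left_mono) auto
        also have "\<dots> \<le> C"
          using C[of i] by simp
        finally show ?thesis
          using v by (simp add: field_simps)
      qed
      have bz: "norm (b i *\<^sub>R z i) \<le> C / \<bar>v 0\<bar> * t i" for i
        unfolding norm_scaleR
        by (rule mult_mono[OF bound z order_trans[OF abs_ge_zero bound] norm_ge_zero])
      have "summable (\<lambda>i. b i *\<^sub>R z i)"
        by (rule summable_comparison_test'[OF summable_mult[OF t, of "C / \<bar>v 0\<bar>"], of 0]) (rule bz)
      then have "summable (\<lambda>i. b i *\<^sub>R y' i + b i *\<^sub>R z i)"
        using b summable_iff summable_add by blast
      then show ?thesis
        by (simp add: split scaleR_add_right)
    qed
    show "summable (\<lambda>i. b i *\<^sub>R ?y i)" if b: "summable (\<lambda>i. b i *\<^sub>R (?y \<circ> r) i)"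
    proof -
      have le: "norm (\<Sum>i\<in>F. b i *\<^sub>R y' i) \<le> norm (\<Sum>i\<in>F. b i *\<^sub>R (?y \<circ> r) i)" if F: "finite F" for F
      proof -
        let ?f = "\<lambda>x. b (fst x) * v (snd x)" and ?g = "\<lambda>x. case x of (i, d) \<Rightarrow> ?p (r i) + d"
        have "norm (\<Sum>x\<in>Sigma F (\<lambda>i. {..<q i}). ?f x *\<^sub>R e (?g x))
            \<le> norm (\<Sum>x\<in>Sigma F (\<lambda>i. {..<q (r i)}). ?f x *\<^sub>R e (?g x))"
          using F q_le position_inj_on[OF sep_r']
          by (intro one_unconditional_mono[OF unc]) (auto intro: order_less_le_trans)
        then show ?thesis
          using F by (simp add: y'_def truncated_copies_def scaleR_sum_right sum.Sigma case_prod_unfold)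
      qed
      have "summable (\<lambda>i. b i *\<^sub>R y' i)"
        unfolding summable_Cauchy
      proof (intro allI impI)
        fix \<epsilon> :: real assume "\<epsilon> > 0"
        then obtain M where "\<And>m n. m \<ge> M \<Longrightarrow> norm (\<Sum>i=m..<n. b i *\<^sub>R (?y \<circ> r) i) < \<epsilon>"
          using b unfolding summable_Cauchy by blast
        then show "\<exists>M. \<forall>m\<ge>M. \<forall>n. norm (\<Sum>i=m..<n. b i *\<^sub>R y' i) < \<epsilon>"
          using order_le_less_trans[OF le] by (intro exI[of _ M]) auto
      qed
      then show ?thesis
        using summable_iff by blast
    qed
  qed
  then show ?thesis
    unfolding subsymmetric_def
    using block_basis_unconditional[OF basis unc block] by blast
qed

section \<open>Elementary estimates for the fundamental function\<close>

lemma fundamental_function_mono: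
  fixes e :: "nat \<Rightarrow> 'a::real_normed_vector"
  assumes e: "one_unconditional e" and "m \<le> n"
  shows "fundamental_function e m \<le> fundamental_function e n"
  using one_unconditional_mono[OF e, of "{..<n}" "\<lambda>k. k" "{..<m}" "\<lambda>_. 1" "\<lambda>_. 1"] assms
  by (simp add: fundamental_function_def)

lemma fundamental_function_ge_1:
  fixes e :: "nat \<Rightarrow> 'a::real_normed_vector"
  assumes e: "one_unconditional e" and norm: "normalized e" and "n > 0"
  shows "fundamental_function e n \<ge> 1"
proof -
  have "fundamental_function e 1 = 1"
    using norm by (simp add: fundamental_function_def normalized_def)
  then show ?thesis
    using fundamental_function_mono[OF e, of 1 n] \<open>n > 0\<close> by simp
qed

lemma fundamental_function_add_le:
  fixes e :: "nat \<Rightarrow> 'a::real_normed_vector"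
  assumes e: "one_subsymmetric e"
  shows "fundamental_function e (m + n) \<le> fundamental_function e m + fundamental_function e n"
proof -
  have "fundamental_function e (m + n) = norm ((\<Sum>i<m. e i) + (\<Sum>i\<in>{m..<m + n}. e i))"
    by (simp add: fundamental_function_def lessThan_atLeast0 sum.atLeastLessThan_concat)
  also have "\<dots> \<le> fundamental_function e m + norm (\<Sum>i\<in>{m..<m + n}. e i)"
    unfolding fundamental_function_def by (rule norm_triangle_ineq)
  also have "norm (\<Sum>i\<in>{m..<m + n}. e i) = fundamental_function e n"
    using norm_sum_basis_eq_fundamental_function[OF e, of "{m..<m + n}" "\<lambda>i. i"] by simp
  finally show ?thesis by simp
qed

lemma fundamental_function_mult_le:
  fixes e :: "nat \<Rightarrow> 'a::real_normed_vector"
  assumes e: "one_subsymmetric e"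
  shows "fundamental_function e (m * n) \<le> real m * fundamental_function e n"
proof (induction m)
  case 0
  show ?case by (simp add: fundamental_function_def)
next
  case (Suc m)
  then show ?case
    using fundamental_function_add_le[OF e, of n "m * n"] by (simp add: distrib_right)
qed

section \<open>Copies of a vector made of flat pieces\<close>

text \<open>
  Offset 0 carries the leading coefficient 1, so piece \<open>j\<close> of length \<open>N j\<close> begins one place
  later than the sum of the preceding lengths.
\<close>
definition piece_start :: "(nat \<Rightarrow> nat) \<Rightarrow> nat \<Rightarrow> nat" where
  "piece_start N j = Suc (\<Sum>l<j. N l)"

text \<open>
  The sequence \<open>1, h\<^sub>0, \<dots>, h\<^sub>0, h\<^sub>1, \<dots>, h\<^sub>1, \<dots>\<close> in which \<open>h\<^sub>j\<close> occurs \<open>N j\<close> times.  The leading 1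
  makes every truncated copy nonzero.
\<close>
definition flat_pieces :: "(nat \<Rightarrow> nat) \<Rightarrow> (nat \<Rightarrow> real) \<Rightarrow> nat \<Rightarrow> real" where
  "flat_pieces N h d =
     (if d = 0 then 1 else h (THE j. d \<in> {piece_start N j..<piece_start N (Suc j)}))"

lemma piece_start_Suc: "piece_start N (Suc j) = piece_start N j + N j"
  by (simp add: piece_start_def)

lemma strict_mono_piece_start:
  assumes "\<And>j. N j > 0"
  shows "strict_mono (piece_start N)"
  using assms by (simp add: strict_mono_Suc_iff piece_start_Suc)

lemma flat_pieces_0 [simp]: "flat_pieces N h 0 = 1"
  by (simp add: flat_pieces_def)

lemma flat_pieces_piece:
  assumes N: "\<And>j. N j > 0" and k: "k < N j"
  shows "flat_pieces N h (piece_start N j + k) = h j"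
proof -
  have "(THE i. piece_start N j + k \<in> {piece_start N i..<piece_start N (Suc i)}) = j"
    using k
    by (intro the_equality block_index_unique[OF strict_mono_piece_start[of N, OF N]])
       (auto simp: piece_start_Suc)
  then show ?thesis
    by (simp add: flat_pieces_def piece_start_def)
qed

lemma sum_ivl_append:
  fixes f :: "nat \<Rightarrow> 'a::comm_monoid_add"
  assumes "a \<le> b"
  shows "(\<Sum>d\<in>{a..<b + n}. f d) = (\<Sum>d\<in>{a..<b}. f d) + (\<Sum>k<n. f (b + k))"
  using assms by (induction n) (simp_all add: add.assoc)

lemma sum_pieces:
  fixes f :: "nat \<Rightarrow> 'a::comm_monoid_add"
  assumes N: "\<And>j. N j > 0" and "i \<le> m"
  shows "(\<Sum>d\<in>{piece_start N i..<piece_start N m}. f d)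
    = (\<Sum>j\<in>{i..<m}. \<Sum>k<N j. f (piece_start N j + k))"
  using \<open>i \<le> m\<close>
proof (induction m rule: dec_induct)
  case (step m)
  have "piece_start N i \<le> piece_start N m"
    using strict_mono_less_eq[OF strict_mono_piece_start[of N, OF N]] step.hyps by simp
  then show ?case
    using step by (simp add: piece_start_Suc sum_ivl_append)
qed simp

lemma sum_triangle_swap:
  fixes f :: "nat \<Rightarrow> nat \<Rightarrow> 'a::comm_monoid_add"
  shows "(\<Sum>i<n. \<Sum>j<i. f i j) = (\<Sum>j<n. \<Sum>i\<in>{Suc j..<n}. f i j)"
  by (induction n) (simp_all add: sum.distrib)

lemma norm_flat_pieces_tail_le:
  fixes e :: "nat \<Rightarrow> 'a::real_normed_vector"
  assumes e: "one_subsymmetric e" and N: "\<And>j. N j > 0" and "i \<le> m"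
  shows "norm (\<Sum>d\<in>{piece_start N i..<piece_start N m}. flat_pieces N h d *\<^sub>R e d)
    \<le> (\<Sum>j\<in>{i..<m}. \<bar>h j\<bar> * fundamental_function e (N j))"
proof -
  have "norm (\<Sum>k<N j. flat_pieces N h (piece_start N j + k) *\<^sub>R e (piece_start N j + k))
      = \<bar>h j\<bar> * fundamental_function e (N j)" for j
  proof -
    have "(\<Sum>k<N j. flat_pieces N h (piece_start N j + k) *\<^sub>R e (piece_start N j + k))
        = h j *\<^sub>R (\<Sum>k<N j. e (piece_start N j + k))"
      using flat_pieces_piece[of N, OF N] by (simp add: scaleR_sum_right)
    then show ?thesis
      using norm_sum_basis_eq_fundamental_function[OF e, of "{..<N j}" "\<lambda>k. piece_start N j + k"]
      by simp
  qed
  then show ?thesis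
    unfolding sum_pieces[of N, OF N \<open>i \<le> m\<close>] by (simp add: sum_norm_le)
qed

text \<open>
  Copy \<open>i\<close> is truncated at the start of piece \<open>i\<close>, so among the first \<open>n\<close> copies exactly those numbered
  from \<open>Suc j\<close> on contain piece \<open>j\<close>.
\<close>
definition piece_indices :: "(nat \<Rightarrow> nat) \<Rightarrow> nat \<Rightarrow> nat \<Rightarrow> (nat \<times> nat) set" where
  "piece_indices N n j = {Suc j..<n} \<times> {piece_start N j..<piece_start N (Suc j)}"

lemma piece_indices_subset:
  assumes N: "\<And>j. N j > 0"
  shows "piece_indices N n j \<subseteq> Sigma {..<n} (\<lambda>i. {..<piece_start N i})"
proof
  fix x assume "x \<in> piece_indices N n j"
  then obtain i d where x: "x = (i, d)" "Suc j \<le> i" "i < n" "d < piece_start N (Suc j)"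
    by (auto simp: piece_indices_def)
  have "piece_start N (Suc j) \<le> piece_start N i"
    using strict_mono_less_eq[OF strict_mono_piece_start[of N, OF N]] x(2) by simp
  with x show "x \<in> Sigma {..<n} (\<lambda>i. {..<piece_start N i})"
    by simp
qed

lemma norm_sum_piece_indices:
  fixes e :: "nat \<Rightarrow> 'a::real_normed_vector"
  assumes e: "one_subsymmetric e" and N: "\<And>j. N j > 0"
  shows "norm (\<Sum>(i, d)\<in>piece_indices N n j. e (copy_start (piece_start N) i + d))
    = fundamental_function e ((n - Suc j) * N j)"
proof -
  have "inj_on (\<lambda>(i, d). copy_start (piece_start N) i + d) (piece_indices N n j)"
    using position_inj_on[of "copy_start (piece_start N)", OF copy_start_separated]
      piece_indices_subset[of N, OF N] by (rule inj_on_subset)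
  then show ?thesis
    using norm_sum_basis_eq_fundamental_function[OF e, of "piece_indices N n j"
        "\<lambda>(i, d). copy_start (piece_start N) i + d"]
    by (simp add: case_prod_unfold) (simp add: piece_indices_def piece_start_Suc)
qed

lemma flat_pieces_on_piece_indices:
  assumes N: "\<And>j. N j > 0" and x: "(i, d) \<in> piece_indices N n j"
  shows "flat_pieces N h d = h j"
  using flat_pieces_piece[of N "d - piece_start N j" j h, OF N] x
  by (auto simp: piece_indices_def piece_start_Suc)

text \<open>
  Only the coordinates in piece \<open>j\<close> are kept; there all coefficients equal \<open>h j\<close>.
\<close>
lemma fundamental_function_copies_ge:
  fixes e :: "nat \<Rightarrow> 'a::real_normed_vector"
  assumes e: "one_subsymmetric e" and N: "\<And>j. N j > 0"
  shows "\<bar>h j\<bar> * fundamental_function e ((n - Suc j) * N j)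
    \<le> fundamental_function (truncated_copies e (flat_pieces N h) (piece_start N)) n"
proof -
  let ?g = "\<lambda>(i, d). copy_start (piece_start N) i + d"
  let ?J = "Sigma {..<n} (\<lambda>i. {..<piece_start N i})"
  have unc: "one_unconditional e"
    using e by (simp add: one_subsymmetric_def)
  have "\<bar>h j\<bar> * fundamental_function e ((n - Suc j) * N j)
      = norm (\<Sum>x\<in>piece_indices N n j. h j *\<^sub>R e (?g x))"
    using norm_sum_piece_indices[OF e, of N n j, OF N, symmetric]
    by (simp add: scaleR_sum_right[symmetric] case_prod_unfold)
  also have "\<dots> \<le> norm (\<Sum>x\<in>?J. flat_pieces N h (snd x) *\<^sub>R e (?g x))"
  proof (rule one_unconditional_mono[OF unc])
    show "inj_on ?g ?J"
      using copy_start_separated by (rule position_inj_on)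
    show "piece_indices N n j \<subseteq> ?J"
      using N by (rule piece_indices_subset)
    show "\<bar>h j\<bar> \<le> \<bar>flat_pieces N h (snd x)\<bar>" if "x \<in> piece_indices N n j" for x
      using flat_pieces_on_piece_indices[of N "fst x" "snd x" n j h, OF N] that by simp
  qed simp
  also have "(\<Sum>x\<in>?J. flat_pieces N h (snd x) *\<^sub>R e (?g x))
      = (\<Sum>i<n. truncated_copies e (flat_pieces N h) (piece_start N) i)"
    by (simp add: truncated_copies_def sum.Sigma case_prod_unfold)
  finally show ?thesis
    by (simp add: fundamental_function_def)
qed

text \<open>
  The sum of the copies is split into the leading vectors and, for each \<open>j\<close>, all occurrences of
  piece \<open>j\<close>, at most \<open>n\<close> in number.
\<close>
lemma fundamental_function_copies_le:
  fixes e :: "nat \<Rightarrow> 'a::real_normed_vector"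
  assumes e: "one_subsymmetric e" and N: "\<And>j. N j > 0"
  shows "fundamental_function (truncated_copies e (flat_pieces N h) (piece_start N)) n
    \<le> fundamental_function e n + (\<Sum>j<n. \<bar>h j\<bar> * fundamental_function e (n * N j))"
proof -
  let ?q = "piece_start N"
  let ?p = "copy_start ?q"
  let ?E = "\<lambda>j. \<Sum>(i, d)\<in>piece_indices N n j. e (?p i + d)"
  have p: "strict_mono ?p"
    by (simp add: strict_mono_Suc_iff copy_start_def piece_start_def)
  have copy: "truncated_copies e (flat_pieces N h) ?q i
      = e (?p i) + (\<Sum>j<i. \<Sum>d\<in>{?q j..<?q (Suc j)}. h j *\<^sub>R e (?p i + d))" for i
  proof -
    let ?f = "\<lambda>d. flat_pieces N h d *\<^sub>R e (?p i + d)"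
    have "{..<?q i} = insert 0 {?q 0..<?q i}"
      by (auto simp: piece_start_def)
    then have "truncated_copies e (flat_pieces N h) ?q i = e (?p i) + (\<Sum>d\<in>{?q 0..<?q i}. ?f d)"
      by (simp add: truncated_copies_def piece_start_def)
    also have "(\<Sum>d\<in>{?q 0..<?q i}. ?f d) = (\<Sum>j<i. \<Sum>d\<in>{?q j..<?q (Suc j)}. ?f d)"
      by (rule sum_blocks[OF strict_mono_piece_start[of N, OF N], symmetric])
    also have "\<dots> = (\<Sum>j<i. \<Sum>d\<in>{?q j..<?q (Suc j)}. h j *\<^sub>R e (?p i + d))"
    proof (intro sum.cong refl)
      fix j d assume "j \<in> {..<i}" "d \<in> {?q j..<?q (Suc j)}"
      then have "(i, d) \<in> piece_indices N (Suc i) j"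
        by (auto simp: piece_indices_def)
      then show "?f d = h j *\<^sub>R e (?p i + d)"
        using flat_pieces_on_piece_indices[of N, OF N] by simp
    qed
    finally show ?thesis .
  qed
  have "(\<Sum>i<n. truncated_copies e (flat_pieces N h) ?q i) = (\<Sum>i<n. e (?p i)) + (\<Sum>j<n. h j *\<^sub>R ?E j)"
    by (simp add: copy sum.distrib sum_triangle_swap piece_indices_def sum.cartesian_product scaleR_sum_right
        case_prod_unfold)
  then have "fundamental_function (truncated_copies e (flat_pieces N h) ?q) n
      \<le> norm (\<Sum>i<n. e (?p i)) + norm (\<Sum>j<n. h j *\<^sub>R ?E j)"
    unfolding fundamental_function_def by (simp add: norm_triangle_ineq)
  also have "norm (\<Sum>i<n. e (?p i)) = fundamental_function e n"
    using norm_sum_basis_eq_fundamental_function[OF e, of "{..<n}" ?p] strict_mono_imp_inj_on[OF p]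
    by (simp add: inj_on_subset)
  also have "norm (\<Sum>j<n. h j *\<^sub>R ?E j) \<le> (\<Sum>j<n. \<bar>h j\<bar> * fundamental_function e (n * N j))"
  proof (rule sum_norm_le)
    fix j
    have "fundamental_function e ((n - Suc j) * N j) \<le> fundamental_function e (n * N j)"
      using e by (intro fundamental_function_mono) (auto simp: one_subsymmetric_def)
    then show "norm (h j *\<^sub>R ?E j) \<le> \<bar>h j\<bar> * fundamental_function e (n * N j)"
      using norm_sum_piece_indices[OF e, of N n j, OF N] by (simp add: mult_left_mono)
  qed
  finally show ?thesis by simp
qed

section \<open>Recursive choices and sets with infinite differences\<close>

text \<open>
  The constant to be beaten at step \<open>j\<close> may depend on the sums of the earlier choices, so that each
  pair \<open>(n\<^sub>j, N\<^sub>j)\<close> can dominate everything chosen before.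
\<close>
lemma not_submultiplicative_choice:
  fixes \<Phi> :: "nat \<Rightarrow> real" and C :: "nat \<Rightarrow> nat \<Rightarrow> nat \<Rightarrow> real"
  assumes nsub: "\<not> submultiplicative \<Phi>" and C: "\<And>j a b. C j a b > 0"
  obtains n N where
    "\<And>j. C j (\<Sum>i<j. n i) (\<Sum>i<j. N i) * \<Phi> (n j) * \<Phi> (N j) < \<Phi> (n j * N j)"
proof -
  have "\<exists>f :: nat \<Rightarrow> nat \<times> nat. \<forall>j. C j (\<Sum>i<j. fst (f i)) (\<Sum>i<j. snd (f i))
      * \<Phi> (fst (f j)) * \<Phi> (snd (f j)) < \<Phi> (fst (f j) * snd (f j))"
  proof (rule dependent_wellorder_choice)
    fix r and f g :: "nat \<Rightarrow> nat \<times> nat" and j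
    assume "\<And>i. i < j \<Longrightarrow> f i = g i"
    then have "(\<Sum>i<j. fst (f i)) = (\<Sum>i<j. fst (g i))" "(\<Sum>i<j. snd (f i)) = (\<Sum>i<j. snd (g i))"
      by simp_all
    then show "(C j (\<Sum>i<j. fst (f i)) (\<Sum>i<j. snd (f i)) * \<Phi> (fst r) * \<Phi> (snd r) < \<Phi> (fst r * snd r))
        = (C j (\<Sum>i<j. fst (g i)) (\<Sum>i<j. snd (g i)) * \<Phi> (fst r) * \<Phi> (snd r) < \<Phi> (fst r * snd r))"
      by (simp only:)
  next
    fix j and f :: "nat \<Rightarrow> nat \<times> nat"
    obtain m n where "C j (\<Sum>i<j. fst (f i)) (\<Sum>i<j. snd (f i)) * \<Phi> n * \<Phi> m < \<Phi> (n * m)"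
      using nsub C[of j "\<Sum>i<j. fst (f i)" "\<Sum>i<j. snd (f i)"]
      unfolding submultiplicative_def not_ex not_all not_le de_Morgan_conj by blast
    then show "\<exists>r. C j (\<Sum>i<j. fst (f i)) (\<Sum>i<j. snd (f i)) * \<Phi> (fst r) * \<Phi> (snd r) < \<Phi> (fst r * snd r)"
      by (intro exI[of _ "(n, m)"]) simp
  qed
  then obtain f :: "nat \<Rightarrow> nat \<times> nat" where
    "\<forall>j. C j (\<Sum>i<j. fst (f i)) (\<Sum>i<j. snd (f i)) * \<Phi> (fst (f j)) * \<Phi> (snd (f j))
      < \<Phi> (fst (f j) * snd (f j))"
    by blast
  then show thesis
    by (intro that[of "\<lambda>j. fst (f j)" "\<lambda>j. snd (f j)"]) blast
qed

text \<open>
  Each number \<open>i\<close> contributes the code \<open>2i\<close> or \<open>2i + 1\<close> according to its membership in \<open>X\<close>, so different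
  sets are incomparable; pairing every code with all \<open>m\<close> makes each difference infinite.
\<close>
definition mutually_infinite_set :: "nat set \<Rightarrow> nat set" where
  "mutually_infinite_set X =
     {prod_encode (m, k) |m k. k \<in> (\<lambda>i. 2 * i) ` X \<union> (\<lambda>i. 2 * i + 1) ` (- X)}"

lemma mutually_infinite_set_diff_infinite:
  assumes "X \<noteq> Y"
  shows "infinite (mutually_infinite_set X - mutually_infinite_set Y)"
proof -
  have "\<exists>k. k \<in> (\<lambda>i. 2 * i) ` X \<union> (\<lambda>i. 2 * i + 1) ` (- X)
      \<and> k \<notin> (\<lambda>i. 2 * i) ` Y \<union> (\<lambda>i. 2 * i + 1) ` (- Y)"
  proof -
    obtain i where "i \<in> X \<longleftrightarrow> i \<notin> Y"
      using assms by blast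
    then consider "i \<in> X" "i \<notin> Y" | "i \<notin> X" "i \<in> Y"
      by blast
    then show ?thesis
    proof cases
      case 1
      then show ?thesis by (intro exI[of _ "2 * i"]) (auto, presburger)
    next
      case 2
      then show ?thesis by (intro exI[of _ "2 * i + 1"]) (auto, presburger)
    qed
  qed
  then obtain k where k: "k \<in> (\<lambda>i. 2 * i) ` X \<union> (\<lambda>i. 2 * i + 1) ` (- X)"
    "k \<notin> (\<lambda>i. 2 * i) ` Y \<union> (\<lambda>i. 2 * i + 1) ` (- Y)"
    by blast
  have "range (\<lambda>m. prod_encode (m, k)) \<subseteq> mutually_infinite_set X - mutually_infinite_set Y"
    using k unfolding mutually_infinite_set_def by (auto simp del: Un_iff)
  moreover have "infinite (range (\<lambda>m. prod_encode (m, k)))"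
    by (rule range_inj_infinite) (auto simp: inj_def)
  ultimately show ?thesis
    using finite_subset by blast
qed

lemma sum_half_powers_ivl_le:
  "(\<Sum>j\<in>{i..<m}. (1/2) ^ Suc j) \<le> ((1/2) ^ i :: real)"
proof (cases "i \<le> m")
  case True
  then have "(\<Sum>j\<in>{i..<m}. (1/2) ^ Suc j) = (1/2) ^ i - (1/2 :: real) ^ m"
    by (induction m rule: dec_induct) simp_all
  then show ?thesis by simp
qed simp

section \<open>A continuum of inequivalent fundamental functions\<close>

theorem theorem27:
  fixes e :: "nat \<Rightarrow> 'a::banach"
  assumes "schauder_basis e"
    and "normalized e"
    and "one_subsymmetric e"
    and "\<not> submultiplicative (fundamental_function e)"
  shows "\<exists>S :: (nat \<Rightarrow> 'a) set.
           S \<approx> (UNIV :: nat set set) \<and>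
           (\<forall>y\<in>S. block_basis e y \<and> subsymmetric y) \<and>
           (\<forall>y\<in>S. \<forall>z\<in>S. y \<noteq> z \<longrightarrow>
              \<not> equivalent_fun (fundamental_function y) (fundamental_function z))"
proof -
  note basis = assms(1) and norm = assms(2) and sub = assms(3)
  let ?\<Phi> = "fundamental_function e"
  have unc: "one_unconditional e"
    using sub by (simp add: one_subsymmetric_def)
  note mono = fundamental_function_mono[OF unc]
    and ge_1 = fundamental_function_ge_1[OF unc norm]
    and add_le = fundamental_function_add_le[OF sub]
    and mult_le = fundamental_function_mult_le[OF sub]
  \<comment> \<open>\<open>a\<close> and \<open>b\<close> stand for the sums of the earlier \<open>n\<close> and \<open>N\<close>; the constant is
    \<open>(j + 1) (1 + R j / c j)\<close> for the \<open>R\<close> and \<open>c\<close> defined next.\<close>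
  let ?C = "\<lambda>(j :: nat) (a :: nat) (b :: nat). real (Suc j) * (1 + (2 + real b) * (2 ^ Suc j * (1 + real a)))"
  have C: "?C j a b > 0" for j a b
    by (intro mult_pos_pos add_pos_nonneg mult_nonneg_nonneg) auto
  obtain n N where
    nN: "\<And>j. ?C j (\<Sum>i<j. n i) (\<Sum>i<j. N i) * ?\<Phi> (n j) * ?\<Phi> (N j) < ?\<Phi> (n j * N j)"
    using not_submultiplicative_choice[of ?\<Phi> ?C, OF assms(4) C] by metis
  \<comment> \<open>The weight \<open>c j\<close> is so small that the later pieces are negligible at all earlier \<open>n i\<close>;
    \<open>R j\<close> bounds the sum of the first \<open>n j\<close> copies, relative to \<open>\<Phi> (n j)\<close>, when piece \<open>j\<close> is absent.  Its
    summand 2 accounts for the leading vectors and for all later pieces.\<close>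
  define c where "c j = (1/2) ^ Suc j / (1 + real (\<Sum>i<j. n i))" for j
  define R where "R j = 2 + real (\<Sum>i<j. N i)" for j
  have c_pos: "c j > 0" for j
    unfolding c_def by (intro divide_pos_pos add_pos_nonneg) (simp_all add: sum_nonneg)
  have R_pos: "R j > 0" for j
    unfolding R_def by (intro add_pos_nonneg) (simp_all add: sum_nonneg)
  have c_mult_le: "c i * real m \<le> (1/2) ^ Suc i" if "real m \<le> 1 + real (\<Sum>l<i. n l)" for i m
  proof -
    have "c i * real m \<le> c i * (1 + real (\<Sum>l<i. n l))"
      using that c_pos[of i] by (intro mult_left_mono) auto
    also have "\<dots> = (1/2) ^ Suc i"
    proof -
      have "1 + real (\<Sum>l<i. n l) \<noteq> 0"
        by linarith
      note cancel = nonzero_mult_div_cancel_right[OF this]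
      show ?thesis
        unfolding c_def times_divide_eq_left by (rule cancel)
    qed
    finally show ?thesis .
  qed
  have c_le: "c i \<le> (1/2) ^ Suc i" for i
    using c_mult_le[of 1 i] by (simp add: sum_nonneg)
  have c_le_1: "c i \<le> 1" for i
    using c_le[of i] power_le_one[of "1/2 :: real" "Suc i"] by linarith
  have large: "real (Suc j) * (1 + R j / c j) * ?\<Phi> (n j) * ?\<Phi> (N j) < ?\<Phi> (n j * N j)" for j
  proof -
    have "R j / c j = (2 + real (\<Sum>i<j. N i)) * (2 ^ Suc j * (1 + real (\<Sum>i<j. n i)))"
      by (simp add: R_def c_def power_divide field_simps)
    then show ?thesis
      using nN[of j] by (simp only:)
  qed
  have pos: "n j > 0 \<and> N j > 0" for j
  proof (rule ccontr)
    assume "\<not> (n j > 0 \<and> N j > 0)"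
    then have "n j * N j = 0"
      by simp
    then have "?\<Phi> (n j * N j) = 0" "?\<Phi> (n j) = 0 \<or> ?\<Phi> (N j) = 0"
      by (auto simp: fundamental_function_def)
    with large[of j] show False
      by auto
  qed
  have N_pos: "\<And>j. N j > 0"
    using pos by blast
  have \<Phi>N: "?\<Phi> (N j) \<ge> 1" and \<Phi>n: "?\<Phi> (n j) \<ge> 1" for j
    using pos ge_1 by blast+
  define h where "h A j = (if j \<in> A then c j / ?\<Phi> (N j) else 0)" for A j
  define y where "y A = truncated_copies e (flat_pieces N (h A)) (piece_start N)" for A
  have h_le: "\<bar>h A j\<bar> * ?\<Phi> (N j) \<le> c j" for A j
    using \<Phi>N[of j] c_pos[of j] by (simp add: h_def)
  have block: "block_basis e (y A)" for A
    unfolding y_def by (rule truncated_copies_block_basis[OF unc norm]) (simp_all add: piece_start_def)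
  have subsymmetric: "subsymmetric (y A)" for A
    unfolding y_def
  proof (rule truncated_copies_subsymmetric[OF basis norm sub])
    show "strict_mono (piece_start N)"
      using N_pos by (rule strict_mono_piece_start)
    show "summable (\<lambda>i. (1/2 :: real) ^ i)"
      by (rule summable_geometric) simp
    fix i m :: nat assume "i \<le> m"
    have "norm (\<Sum>d\<in>{piece_start N i..<piece_start N m}. flat_pieces N (h A) d *\<^sub>R e d)
        \<le> (\<Sum>j\<in>{i..<m}. \<bar>h A j\<bar> * ?\<Phi> (N j))"
      using sub N_pos \<open>i \<le> m\<close> by (rule norm_flat_pieces_tail_le)
    also have "\<dots> \<le> (\<Sum>j\<in>{i..<m}. (1/2) ^ Suc j)"
      using h_le c_le by (intro sum_mono) (blast intro: order_trans)
    also have "\<dots> \<le> (1/2) ^ i"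
      by (rule sum_half_powers_ivl_le)
    finally show "norm (\<Sum>d\<in>{piece_start N i..<piece_start N m}. flat_pieces N (h A) d *\<^sub>R e d) \<le> (1/2) ^ i" .
  qed (simp_all add: piece_start_def)
  \<comment> \<open>The truncation loses at most \<open>j + 1\<close> of the \<open>n j\<close> occurrences of piece \<open>j\<close>; the summand 1 in
    \<open>1 + R j / c j\<close> pays for them.\<close>
  have lower: "real (Suc j) * R j * ?\<Phi> (n j) \<le> fundamental_function (y A) (n j)" if "j \<in> A" for j A
  proof -
    have "?\<Phi> (n j * N j) \<le> ?\<Phi> ((n j - Suc j) * N j + Suc j * N j)"
      unfolding add_mult_distrib[symmetric] by (intro mono mult_le_mono1) simp
    also have "\<dots> \<le> ?\<Phi> ((n j - Suc j) * N j) + ?\<Phi> (Suc j * N j)"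
      by (rule add_le)
    also have "\<dots> \<le> ?\<Phi> ((n j - Suc j) * N j) + real (Suc j) * ?\<Phi> (N j)"
      using mult_le by (rule add_left_mono)
    finally have "real (Suc j) * (1 + R j / c j) * ?\<Phi> (n j) * ?\<Phi> (N j) - real (Suc j) * ?\<Phi> (N j)
        \<le> ?\<Phi> ((n j - Suc j) * N j)"
      using large[of j] by linarith
    moreover have "real (Suc j) * ?\<Phi> (N j) \<le> real (Suc j) * ?\<Phi> (n j) * ?\<Phi> (N j)"
      using \<Phi>n[of j] \<Phi>N[of j] by (simp add: mult_le_cancel_right1 mult_le_cancel_left1 mult.assoc)
    ultimately have "real (Suc j) * (R j / c j) * ?\<Phi> (n j) * ?\<Phi> (N j) \<le> ?\<Phi> ((n j - Suc j) * N j)"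
      by (simp add: algebra_simps)
    then have "c j / ?\<Phi> (N j) * (real (Suc j) * (R j / c j) * ?\<Phi> (n j) * ?\<Phi> (N j))
        \<le> c j / ?\<Phi> (N j) * ?\<Phi> ((n j - Suc j) * N j)"
      using c_pos[of j] \<Phi>N[of j] by (intro mult_left_mono) auto
    also have "c j / ?\<Phi> (N j) * (real (Suc j) * (R j / c j) * ?\<Phi> (n j) * ?\<Phi> (N j))
        = real (Suc j) * R j * ?\<Phi> (n j)"
      using c_pos[of j] \<Phi>N[of j] by simp
    also have "c j / ?\<Phi> (N j) = \<bar>h A j\<bar>"
      using that c_pos[of j] \<Phi>N[of j] by (simp add: h_def)
    also have "\<bar>h A j\<bar> * ?\<Phi> ((n j - Suc j) * N j) \<le> fundamental_function (y A) (n j)"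
      unfolding y_def using sub N_pos by (rule fundamental_function_copies_ge)
    finally show ?thesis .
  qed
  \<comment> \<open>Earlier pieces are estimated by their lengths, later ones by their weights.\<close>
  have upper: "fundamental_function (y A) (n j) \<le> R j * ?\<Phi> (n j)" if "j \<notin> A" for j A
  proof -
    have summand: "\<bar>h A i\<bar> * ?\<Phi> (n j * N i)
        \<le> (if i < j then real (N i) * ?\<Phi> (n j) else 0) + (1/2) ^ Suc i" for i
    proof (cases i j rule: linorder_cases)
      case less
      have h1: "\<bar>h A i\<bar> \<le> 1"
      proof -
        have "\<bar>h A i\<bar> * 1 \<le> \<bar>h A i\<bar> * ?\<Phi> (N i)"
          using \<Phi>N by (intro mult_left_mono) auto
        then show ?thesis
          using h_le[of A i] c_le_1[of i] by linarith
      qed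
      have "\<bar>h A i\<bar> * ?\<Phi> (n j * N i) \<le> 1 * (real (N i) * ?\<Phi> (n j))"
        using h1 mult_le[of "N i" "n j"]
        by (intro mult_mono) (auto simp: mult.commute fundamental_function_def)
      then show ?thesis
        using less by (simp add: add_increasing2)
    next
      case equal
      then show ?thesis
        using that by (simp add: h_def)
    next
      case greater
      have "n j \<le> (\<Sum>l<i. n l)"
        using greater by (intro member_le_sum) auto
      then have nj: "real (n j) \<le> 1 + real (\<Sum>l<i. n l)"
        by linarith
      have "\<bar>h A i\<bar> * ?\<Phi> (n j * N i) \<le> \<bar>h A i\<bar> * (real (n j) * ?\<Phi> (N i))"
        using mult_le by (intro mult_left_mono) auto
      also have "\<dots> = \<bar>h A i\<bar> * ?\<Phi> (N i) * real (n j)"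
        by simp
      also have "\<dots> \<le> c i * real (n j)"
        using h_le by (intro mult_right_mono) auto
      also have "\<dots> \<le> (1/2) ^ Suc i"
        using nj by (rule c_mult_le)
      finally show ?thesis
        using greater by simp
    qed
    have "(\<Sum>i<n j. \<bar>h A i\<bar> * ?\<Phi> (n j * N i))
        \<le> (\<Sum>i<n j. if i < j then real (N i) * ?\<Phi> (n j) else 0) + (\<Sum>i<n j. (1/2) ^ Suc i)"
      unfolding sum.distrib[symmetric] using summand by (rule sum_mono)
    also have "(\<Sum>i<n j. if i < j then real (N i) * ?\<Phi> (n j) else 0)
        = (\<Sum>i\<in>{..<n j} \<inter> {..<j}. real (N i) * ?\<Phi> (n j))"
      by (simp add: sum.inter_restrict)
    also have "\<dots> \<le> (\<Sum>i<j. real (N i) * ?\<Phi> (n j))"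
      using \<Phi>n[of j] by (intro sum_mono2) auto
    also have "\<dots> = real (\<Sum>i<j. N i) * ?\<Phi> (n j)"
      by (simp add: sum_distrib_right)
    also have "(\<Sum>i<n j. (1/2) ^ Suc i) \<le> (1 :: real)"
      using sum_half_powers_ivl_le[of 0 "n j"] by (simp add: lessThan_atLeast0)
    finally have "(\<Sum>i<n j. \<bar>h A i\<bar> * ?\<Phi> (n j * N i)) \<le> real (\<Sum>i<j. N i) * ?\<Phi> (n j) + ?\<Phi> (n j)"
      using \<Phi>n[of j] by simp
    moreover have "fundamental_function (y A) (n j)
        \<le> ?\<Phi> (n j) + (\<Sum>i<n j. \<bar>h A i\<bar> * ?\<Phi> (n j * N i))"
      unfolding y_def using sub N_pos by (rule fundamental_function_copies_le)
    ultimately show ?thesis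
      by (simp add: R_def distrib_right)
  qed
  have not_equiv: "\<not> equivalent_fun (fundamental_function (y A)) (fundamental_function (y B))"
    if inf: "infinite (B - A)" for A B
  proof
    assume "equivalent_fun (fundamental_function (y A)) (fundamental_function (y B))"
    then obtain K where K: "K > 0"
      "\<And>m. fundamental_function (y B) m \<le> K * fundamental_function (y A) m"
      unfolding equivalent_fun_def by blast
    obtain k where k: "K < real k"
      using reals_Archimedean2 by blast
    obtain j where j: "j > k" "j \<in> B - A"
      using inf unfolding infinite_nat_iff_unbounded by blast
    have "real (Suc j) * (R j * ?\<Phi> (n j)) \<le> fundamental_function (y B) (n j)"
      using lower[of j B] j by (simp add: mult.assoc)
    also have "\<dots> \<le> K * fundamental_function (y A) (n j)"
      by (rule K)
    also have "\<dots> \<le> K * (R j * ?\<Phi> (n j))"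
      using upper[of j A] j K(1) by (intro mult_left_mono) auto
    finally have "real (Suc j) \<le> K"
      using R_pos[of j] \<Phi>n[of j] by (simp add: mult_le_cancel_right)
    with j k show False by linarith
  qed
  let ?y = "\<lambda>X. y (mutually_infinite_set X)"
  have distinct: "\<not> equivalent_fun (fundamental_function (?y X)) (fundamental_function (?y Y))"
    if "X \<noteq> Y" for X Y
    using mutually_infinite_set_diff_infinite[of Y X] that by (intro not_equiv) auto
  have refl: "equivalent_fun \<Psi> \<Psi>" for \<Psi>
    unfolding equivalent_fun_def by (rule exI[of _ 1]) simp
  have "inj ?y"
    using distinct refl by (metis injI)
  show ?thesis
  proof (intro exI[of _ "range ?y"] conjI ballI impI)
    show "range ?y \<approx> (UNIV :: nat set set)"
      using \<open>inj ?y\<close> by (rule inj_on_image_eqpoll_self)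
  next
    fix u assume "u \<in> range ?y"
    then obtain X where u: "u = ?y X" by auto
    show "block_basis e u" "subsymmetric u"
      unfolding u by (rule block, rule subsymmetric)
    fix v assume "v \<in> range ?y" "u \<noteq> v"
    then obtain Y where v: "v = ?y Y" "X \<noteq> Y"
      using u by auto
    show "\<not> equivalent_fun (fundamental_function u) (fundamental_function v)"
      unfolding u v(1) using v(2) by (rule distinct)
  qed
qed

end
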